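(* Let $m$ be a Carmichael number with exactly three prime factors such that $m\notin\mathcal C'_3$. Then $m\in(\mathcal S'\cap\mathcal L)\setminus\mathcal S$, and the greatest prime divisor $p$ of $m$ satisfies $s_p(m)=p$. Moreover, writing $m=p_1p_2p_3$ with primes $p_1<p_2<p_3$, $u=\gcd(p_1-1,p_2-1,p_3-1)$ and $\mathbf r=((p_1-1)/u,(p_2-1)/u,(p_3-1)/u)$, we have $\mathbf r\in\mathcal R$ and there is an integer $t$ with $m=U_{\mathbf r}(t)$ and $0\le t<\tau$, where $\tau=2$ if $r_1=1$ and $\ell<\sigma_3-\sigma_1$, and $\tau=1$ otherwise. In the case $(\tau,t)=(2,1)$, the second greatest prime divisor $p_2$ of $m$ also satisfies $s_{p_2}(m)=p_2$.
   Context: For an integer base $g\ge2$ and $m\ge0$, $s_g(m)$ is the sum of base-$g$ digits of $m$. A Carmichael number is a composite positive $m$ with $a^{m-1}\equiv1\pmod m$ for all $a$ coprime to $m$. $\mathcal C'_3$ is the set of squarefree $m>1$ with exactly three prime factors and $s_p(m)=p$ for every prime $p\mid m$. An $s$-decomposition of a positive integer $m$ is a factorization $m=\prod_{\nu=1}^n g_\nu^{e_\nu}$, $e_\nu\ge1$, with proper factors $1<g_\nu<m$, $g_1<\dots<g_n$ (not necessarily coprime), and $s_{g_\nu}(m)\ge g_\nu$ for all $\nu$; it is strict if $s_{g_\nu}(m)=g_\nu$ for all $\nu$. $\mathcal S'$ (resp. $\mathcal S$) is the set of positive integers admitting an $s$-decomposition (resp. strict one). $\mathcal L$ is the set of positive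 integers $m$ having a divisor $g$ with $s_g(m)=g$. $\mathcal R$ is the set of triples $\mathbf r=(r_1,r_2,r_3)$ of pairwise coprime positive integers with $r_1<r_2<r_3$; for such $\mathbf r$, $\sigma_1=r_1+r_2+r_3$, $\sigma_2=r_1r_2+r_1r_3+r_2r_3$, $\sigma_3=r_1r_2r_3$, $\ell$ is the unique integer with $0\le\ell<\sigma_3$ and $\ell\sigma_2\equiv-\sigma_1\pmod{\sigma_3}$, and $U_{\mathbf r}(t)=\prod_{\nu=1}^3(r_\nu(\sigma_3t+\ell)+1)$. *)

theory Defs
  imports "HOL-Number_Theory.Number_Theory" "HOL-Computational_Algebra.Squarefree"
begin

text \<open>Sum of the base-\<open>g\<close> digits; only meaningful for \<open>g \<ge> 2\<close> (the value is \<open>0\<close> otherwise).\<close>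

function digit_sum :: "nat \<Rightarrow> nat \<Rightarrow> nat" where
  "digit_sum g m = (if g < 2 \<or> m = 0 then 0 else m mod g + digit_sum g (m div g))"
  by auto
termination
  by (relation "measure snd") auto

declare digit_sum.simps [simp del]

definition carmichael :: "nat \<Rightarrow> bool" where
  "carmichael m \<longleftrightarrow> m > 1 \<and> \<not> prime m \<and>
     (\<forall>a::int. coprime a (int m) \<longrightarrow> [a ^ (m - 1) = 1] (mod int m))"

definition \<C>3' :: "nat set" where
  "\<C>3' = {m. m > 1 \<and> squarefree m \<and> card (prime_factors m) = 3 \<and>
     (\<forall>p. prime p \<and> p dvd m \<longrightarrow> digit_sum p m = p)}"

text \<open>The strictly increasing bases \<open>g\<^sub>1 < \<dots> < g\<^sub>n\<close>, \<open>n \<ge> 1\<close>, of a decomposition are given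
  by the finite nonempty set \<open>G\<close> of their values, and \<open>e g\<close> is the exponent belonging to \<open>g\<close>.\<close>

definition proper_factorization :: "nat \<Rightarrow> nat set \<Rightarrow> (nat \<Rightarrow> nat) \<Rightarrow> bool" where
  "proper_factorization m G e \<longleftrightarrow> finite G \<and> G \<noteq> {} \<and>
     (\<forall>g\<in>G. 1 < g \<and> g < m \<and> e g \<ge> 1) \<and> m = (\<Prod>g\<in>G. g ^ e g)"

definition s_decomposition :: "nat \<Rightarrow> nat set \<Rightarrow> (nat \<Rightarrow> nat) \<Rightarrow> bool" where
  "s_decomposition m G e \<longleftrightarrow>
     proper_factorization m G e \<and> (\<forall>g\<in>G. digit_sum g m \<ge> g)"

definition strict_s_decomposition :: "nat \<Rightarrow> nat set \<Rightarrow> (nat \<Rightarrow> nat) \<Rightarrow> bool" where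
  "strict_s_decomposition m G e \<longleftrightarrow>
     s_decomposition m G e \<and> (\<forall>g\<in>G. digit_sum g m = g)"

definition \<S>' :: "nat set" where
  "\<S>' = {m. m > 0 \<and> (\<exists>G e. s_decomposition m G e)}"

definition \<S> :: "nat set" where
  "\<S> = {m. m > 0 \<and> (\<exists>G e. strict_s_decomposition m G e)}"

definition \<L> :: "nat set" where
  "\<L> = {m. m > 0 \<and> (\<exists>g. g \<ge> 2 \<and> g dvd m \<and> digit_sum g m = g)}"

definition \<R> :: "(nat \<times> nat \<times> nat) set" where
  "\<R> = {(r1, r2, r3). 0 < r1 \<and> r1 < r2 \<and> r2 < r3 \<and>
     coprime r1 r2 \<and> coprime r1 r3 \<and> coprime r2 r3}"

text \<open>The elementary symmetric functions are integer-valued, so that \<open>\<sigma>\<^sub>3 - \<sigma>\<^sub>1\<close> is not truncated.\<close>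

fun \<sigma>1 :: "nat \<times> nat \<times> nat \<Rightarrow> int" where
  "\<sigma>1 (r1, r2, r3) = int (r1 + r2 + r3)"

fun \<sigma>2 :: "nat \<times> nat \<times> nat \<Rightarrow> int" where
  "\<sigma>2 (r1, r2, r3) = int (r1 * r2 + r1 * r3 + r2 * r3)"

fun \<sigma>3 :: "nat \<times> nat \<times> nat \<Rightarrow> int" where
  "\<sigma>3 (r1, r2, r3) = int (r1 * r2 * r3)"

text \<open>Existence and uniqueness hold for \<open>r \<in> \<R>\<close>, since then \<open>\<sigma>\<^sub>2\<close> is coprime to \<open>\<sigma>\<^sub>3\<close>.\<close>

definition ell :: "nat \<times> nat \<times> nat \<Rightarrow> int" where
  "ell r = (THE l. 0 \<le> l \<and> l < \<sigma>3 r \<and> [l * \<sigma>2 r = - \<sigma>1 r] (mod \<sigma>3 r))"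

definition U :: "nat \<times> nat \<times> nat \<Rightarrow> int \<Rightarrow> int" where
  "U r t = (case r of (r1, r2, r3) \<Rightarrow>
     (int r1 * (\<sigma>3 r * t + ell r) + 1) *
     (int r2 * (\<sigma>3 r * t + ell r) + 1) *
     (int r3 * (\<sigma>3 r * t + ell r) + 1))"

definition \<tau> :: "nat \<times> nat \<times> nat \<Rightarrow> int" where
  "\<tau> r = (if fst r = 1 \<and> ell r < \<sigma>3 r - \<sigma>1 r then 2 else 1)"

end

theory Submission
  imports Defs
begin

text \<open>
  Write \<open>p\<^sub>i = r\<^sub>i u + 1\<close>. Korselt's criterion says that \<open>p\<^sub>1 p\<^sub>2 p\<^sub>3\<close> is squarefree and that \<open>p\<^sub>i - 1\<close>
  divides the product of the two other primes minus \<open>1\<close>; this makes the \<open>r\<^sub>i\<close> pairwise coprime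
  and gives \<open>\<sigma>\<^sub>3 | \<sigma>\<^sub>2 u + \<sigma>\<^sub>1\<close>, so that \<open>\<ell> = u mod \<sigma>\<^sub>3\<close> and \<open>t = u div \<sigma>\<^sub>3\<close>.
  Digit sums in base \<open>p\<close> are congruent to the number modulo \<open>p - 1\<close>, so all \<open>s\<^bsub>p\<^esub>(m)\<close> are at least \<open>p\<close>,
  and for \<open>p = p\<^sub>3\<close> there is equality because \<open>p\<^sub>1 p\<^sub>2\<close> has two digits only.
  For \<open>u \<ge> \<sigma>\<^sub>3\<close> the cofactor of \<open>p\<^sub>i\<close> has at most three digits in base \<open>p\<^sub>i\<close>; they can be written down and
  sum to \<open>p\<^sub>i\<close>, except that \<open>r\<^sub>1 = 1\<close> needs \<open>u \<ge> 2 \<sigma>\<^sub>3 - \<sigma>\<^sub>1\<close>. Hence \<open>t \<ge> \<tau>\<close> would put \<open>m\<close> into \<open>\<C>\<^sub>3'\<close>.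
  Finally, a base \<open>p\<^sub>j p\<^sub>k\<close> is never strict: \<open>p\<^sub>i - 1 | p\<^sub>j p\<^sub>k - 1\<close> forces \<open>p\<^sub>i < p\<^sub>j p\<^sub>k\<close>, and
  \<open>m\<close> has the digits \<open>p\<^sub>i, 0\<close>;
  so a strict decomposition could only consist of all three primes.
\<close>

section \<open>Korselt's criterion\<close>

text \<open>Some totative has order \<open>Carmichael m\<close>, so \<open>Carmichael m\<close>
  divides \<open>m - 1\<close>; this passes down to \<open>Carmichael (p ^ k)\<close> for each prime
  power \<open>p ^ k\<close> exactly dividing \<open>m\<close>, and \<open>k >= 2\<close> would make
  \<open>p\<close> divide \<open>m - 1\<close>.\<close>

lemma carmichael_korselt:
  assumes "carmichael m"
  shows "squarefree m" and "\<And>p. prime p \<Longrightarrow> p dvd m \<Longrightarrow> p - 1 dvd m - 1"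
proof -
  have m: "m > 1" using assms by (simp add: carmichael_def)
  obtain g where g: "g \<in> totatives m" "ord m g = Carmichael m"
    using Carmichael_root_exists[of m] m by auto
  have "[int g ^ (m - 1) = 1] (mod int m)"
    using assms g(1) by (auto simp: carmichael_def totatives_def)
  then have "[g ^ (m - 1) = 1] (mod m)"
    using cong_int_iff[of "g ^ (m - 1)" 1 m] by simp
  then have lam: "Carmichael m dvd m - 1"
    using g(2) ord_divides by metis
  have *: "multiplicity p m = 1 \<and> p - 1 dvd m - 1" if p: "prime p" "p dvd m" for p
  proof -
    define k where "k = multiplicity p m"
    have k: "k > 0" using p m by (simp add: k_def prime_multiplicity_gt_zero_iff)
    obtain n where n: "m = p ^ k * n" "\<not> p dvd n"
      using multiplicity_decompose'[of m p] p m unfolding k_def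
      by (metis not_prime_unit not_less_zero)
    have "coprime (p ^ k) n" using n p by (simp add: prime_imp_coprime)
    then have "Carmichael (p ^ k) dvd Carmichael m"
      unfolding n(1) by (simp add: Carmichael_mult_coprime)
    then have dv: "Carmichael (p ^ k) dvd m - 1" using lam dvd_trans by blast
    have ndvd: "\<not> p dvd m - 1"
      using p m by (metis dvd_diffD1 less_imp_le_nat not_prime_unit)
    have "k = 1"
    proof (rule ccontr)
      assume "k \<noteq> 1"
      then have k2: "k \<ge> 2" using k by simp
      \<comment> \<open>This includes \<open>p = 2\<close>: \<open>Carmichael (2 ^ k)\<close> is
        even once \<open>k >= 2\<close>.\<close>
      have "p dvd Carmichael (p ^ k)"
        using k2 p(1) by (auto simp: Carmichael_prime_power k)
      then show False using dv ndvd dvd_trans by blast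
    qed
    then show ?thesis using dv p(1) by (simp add: Carmichael_prime k_def)
  qed
  show "squarefree m"
    using m * by (subst squarefree_factorial_semiring') auto
  show "p - 1 dvd m - 1" if "prime p" "p dvd m" for p
    using * that by blast
qed

section \<open>Digit sums and their residues modulo the base minus one\<close>

lemma digit_sum_step:
  assumes "b < g" "2 \<le> g"
  shows "digit_sum g (g * a + b) = b + digit_sum g a"
  using assms by (subst digit_sum.simps) (auto simp: digit_sum.simps[of g 0])

lemma digit_sum_0 [simp]: "digit_sum g 0 = 0"
  by (subst digit_sum.simps) simp

lemma digit_sum_less: "2 \<le> g \<Longrightarrow> b < g \<Longrightarrow> digit_sum g b = b"
  using digit_sum_step[of b g 0] by simp

lemma digit_sum_mult_base: "2 \<le> g \<Longrightarrow> digit_sum g (g * a) = digit_sum g a"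
  using digit_sum_step[of 0 g a] by simp

lemma digit_sum_cong:
  assumes "2 \<le> g"
  shows "[digit_sum g m = m] (mod (g - 1))"
proof (induction m rule: less_induct)
  case (less m)
  show ?case
  proof (cases "m = 0")
    case False
    have "[digit_sum g (m div g) = m div g] (mod (g - 1))"
      using less False assms by simp
    \<comment> \<open>The factor \<open>1\<close> is written out so that it can be exchanged for
      \<open>g\<close>, its equal modulo \<open>g - 1\<close>.\<close>
    then have "[m mod g + digit_sum g (m div g) = m mod g + 1 * (m div g)] (mod (g - 1))"
      by (simp add: cong_add)
    also have "[m mod g + 1 * (m div g) = m mod g + g * (m div g)] (mod (g - 1))"
      using assms by (intro cong_add cong_mult) (auto simp: cong_def le_mod_geq)
    finally show ?thesis
      using assms False by (subst digit_sum.simps) simp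
  qed simp
qed

lemma digit_sum_eq_0: "2 \<le> g \<Longrightarrow> digit_sum g m = 0 \<Longrightarrow> m = 0"
proof (induction m rule: less_induct)
  case (less m)
  show ?case
  proof (rule ccontr)
    assume m: "m \<noteq> 0"
    then have "m mod g = 0" "digit_sum g (m div g) = 0"
      using less.prems by (simp_all add: digit_sum.simps[of g m])
    then show False using less m
      by (metis div_less_dividend less_le_trans one_less_numeral_iff
          semiring_norm(76) mult_div_mod_eq mult_0_right add_0 bot_nat_0.not_eq_extremum)
  qed
qed

lemma digit_sum_eq_1: "2 \<le> g \<Longrightarrow> digit_sum g m = 1 \<Longrightarrow> \<exists>k. m = g ^ k"
proof (induction m rule: less_induct)
  case (less m)
  have m: "m \<noteq> 0" using less.prems by (metis digit_sum_0 zero_neq_one)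
  then have s: "m mod g + digit_sum g (m div g) = 1"
    using less.prems by (simp add: digit_sum.simps[of g m])
  show ?case
  proof (cases "m mod g = 0")
    case True
    then obtain k where "m div g = g ^ k"
      using less s m by fastforce
    then have "m = g ^ Suc k" using True by (metis mod_0_imp_dvd dvd_mult_div_cancel power_Suc)
    then show ?thesis by blast
  next
    case False
    then have "m mod g = 1" "m div g = 0"
      using s less.prems(1) digit_sum_eq_0 by auto
    then have "m = g ^ 0" by (metis mult_div_mod_eq mult_0_right add_0 power_0)
    then show ?thesis by blast
  qed
qed

text \<open>The digit sum is positive and congruent to \<open>1\<close> modulo \<open>g - 1\<close>.
  Below \<open>g\<close> it could only be \<open>1\<close>, which happens for powers of
  \<open>g\<close> alone.\<close>

lemma digit_sum_ge_base:
  assumes g: "2 \<le> g" and m: "m > 0" "g - 1 dvd m - 1" "\<And>k. m \<noteq> g ^ k"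
  shows "g \<le> digit_sum g m"
proof (rule ccontr)
  assume *: "\<not> g \<le> digit_sum g m"
  have "[digit_sum g m = m] (mod (g - 1))" by (rule digit_sum_cong[OF g])
  also have "[m = 1] (mod (g - 1))"
    using m by (metis cong_altdef_nat Suc_leI One_nat_def)
  finally have "[digit_sum g m = 1] (mod (g - 1))" .
  moreover have pos: "digit_sum g m \<ge> 1"
    using digit_sum_eq_0[OF g, of m] m by linarith
  ultimately have "g - 1 dvd digit_sum g m - 1"
    by (simp add: cong_altdef_nat)
  then have "digit_sum g m = 1"
    using * pos g by (metis One_nat_def diff_is_0_eq diff_less_mono dvd_imp_le le_antisym
        linorder_not_le not_less_eq_eq bot_nat_0.not_eq_extremum)
  then show False using digit_sum_eq_1[OF g] m(3) by blast
qed

section \<open>Cofactors whose digit sum equals the base\<close>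

text \<open>The base-\<open>p\<close> digits of \<open>Q\<close> are \<open>A\<close>, \<open>\<rho> + 1 - A\<close> and \<open>p - 1 - \<rho>\<close>.\<close>

lemma digit_sum_eq_base:
  fixes p Q A \<rho> :: nat
  assumes p: "2 \<le> p" and Q: "Q = 1 + (p - 1) * (A * p + \<rho> + 2)"
    and A: "A \<le> \<rho> + 1" and r: "\<rho> < p" and nd: "\<not> p dvd Q"
  shows "digit_sum p Q = p"
proof -
  obtain q where q: "p = q + 1" using p by (metis le_add_diff_inverse2 one_le_numeral order_trans)
  obtain B where B: "\<rho> + 1 = A + B" using A le_Suc_ex by blast
  obtain c where c: "p = \<rho> + 1 + c" using r by (metis Suc_eq_plus1 Suc_leI le_Suc_ex)
  have Q': "Q = p * (p * A + B) + c"
  proof -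
    have "int Q = int (p * (p * A + B) + c)"
    proof -
      have 1: "int B = int \<rho> + 1 - int A" and 2: "int c = int p - 1 - int \<rho>"
        using B c by linarith+
      have "int Q = 1 + (int p - 1) * (int A * int p + int \<rho> + 2)"
        unfolding Q q by (simp add: algebra_simps)
      then show ?thesis using q by (simp add: 1 2 algebra_simps)
    qed
    then show ?thesis by (simp only: of_nat_eq_iff)
  qed
  \<comment> \<open>Non-divisibility excludes \<open>\<rho> = p - 1\<close>, the only case in which
    \<open>A\<close> or \<open>B\<close> could reach \<open>p\<close>.\<close>
  have "c \<noteq> 0" using nd Q' by (metis add_0_right dvd_triv_left)
  then have "c < p" "B < p" "A < p" using B c by linarith+
  then have "digit_sum p Q = c + (B + A)"
    unfolding Q' using p by (simp only: digit_sum_step digit_sum_less)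
  then show ?thesis using B c by linarith
qed

text \<open>The case \<open>A = 0\<close> of \<open>digit_sum_eq_base\<close>: below
  \<open>p * p\<close> the quotient \<open>K\<close> of \<open>Q - 1\<close> by \<open>p - 1\<close>
  is at most \<open>p\<close>.\<close>

lemma digit_sum_eq_base_small:
  fixes p Q :: nat
  assumes p: "2 \<le> p" and Q: "1 < Q" "p - 1 dvd Q - 1" "\<not> p dvd Q" "Q < p * p"
  shows "digit_sum p Q = p"
proof -
  obtain K where "Q - 1 = (p - 1) * K" using Q(2) by blast
  then have K: "Q = 1 + (p - 1) * K" using Q(1) by linarith
  \<comment> \<open>\<open>K = 0\<close> would give \<open>Q = 1\<close>, and \<open>K = 1\<close>
    would give \<open>Q = p\<close>.\<close>
  have "K \<noteq> 0" "K \<noteq> 1" using K Q(1,3) p by auto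
  then have K2: "K = 0 * p + (K - 2) + 2" by simp
  have "(p - 1) * K < (p - 1) * (p + 1)"
    using K Q(4) by (simp add: algebra_simps)
  then have "K < p + 1" by (metis mult_less_cancel1)
  then have "K - 2 < p" using p by linarith
  moreover have "Q = 1 + (p - 1) * (0 * p + (K - 2) + 2)" using K K2 by metis
  ultimately show ?thesis
    using digit_sum_eq_base[of p Q 0 "K - 2"] p Q(3) by simp
qed

text \<open>Coprimality and \<open>x >= 2\<close> keep \<open>y z / x^2\<close> away from the
  integers by at least \<open>1 / x^2\<close>. Since \<open>u >= x y z\<close> makes
  \<open>p\<close> exceed \<open>x^2 y z\<close>, this gap absorbs all rounding errors in the
  digits.\<close>

lemma digit_sum_two_factors_ge2:
  fixes x y z u :: nat
  assumes x: "2 \<le> x" and yz: "2 \<le> y * z" and cop: "coprime x y" "coprime x z"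
    and u: "x * y * z \<le> u" and dv: "x dvd y * z * u + y + z"
    and nd: "\<not> x * u + 1 dvd (y * u + 1) * (z * u + 1)"
  shows "digit_sum (x * u + 1) ((y * u + 1) * (z * u + 1)) = x * u + 1"
proof -
  define p where "p = x * u + 1"
  \<comment> \<open>\<open>p - 1\<close> times \<open>K = (y z u + y + z) / x\<close> is the product minus \<open>1\<close>, and \<open>K\<close> is about \<open>y z p / x\<^sup>2\<close>:
    so \<open>a\<close> is the leading digit.\<close>
  define a where "a = y * z div x\<^sup>2"
  define e where "e = y * z mod x\<^sup>2"
  have ae: "y * z = a * x\<^sup>2 + e" unfolding a_def e_def by (rule div_mult_mod_eq [symmetric])
  have x2: "4 \<le> x\<^sup>2" using power_mono[OF x, of 2] by simp
  have "\<not> x\<^sup>2 dvd y * z"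
  proof
    assume "x\<^sup>2 dvd y * z"
    then have "x dvd y * z" by (auto simp: power2_eq_square intro: dvd_mult_left)
    moreover have "coprime x (y * z)" using cop by simp
    ultimately have "x dvd 1" by (metis coprime_common_divisor dvd_refl)
    then show False using x by simp
  qed
  then have e: "1 \<le> e" "e < x\<^sup>2"
    using x by (auto simp: e_def dvd_eq_mod_eq_0 intro!: mod_less_divisor)
  obtain K where K: "y * z * u + y + z = x * K" using dv by blast
  have u': "2 * x \<le> u" using u yz
    by (metis mult.assoc mult.commute mult_le_mono1 order_trans)
  have up: "1 \<le> u" using u' x by simp
  have "u * 1 \<le> x * K" unfolding K[symmetric] using yz
    by (metis One_nat_def Suc_1 Suc_leD mult.commute mult_le_mono1 trans_le_add1)
  then have "x * 2 \<le> x * K" using u' by linarith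
  then have K2: "2 \<le> K" using x by simp
  define k where "k = int K - 2"
  have k0: "0 \<le> k" using K2 by (simp add: k_def)
  define r where "r = k - int a * int p"
  define X Y Z W V where "X = int x" and "Y = int y" and "Z = int z" and "W = int u" and "V = int a"
  note defs = X_def Y_def Z_def W_def V_def
  have P: "int p = X * W + 1" by (simp add: p_def defs)
  have AE: "Y * Z = V * X\<^sup>2 + int e" using arg_cong[OF ae, of int] by (simp add: defs)
  have KK: "Y * Z * W + Y + Z = X * (k + 2)"
    using arg_cong[OF K, of int] by (simp add: defs k_def)
  \<comment> \<open>Multiplying by \<open>X^2\<close> clears the division: \<open>r\<close> is the
    fraction \<open>e / X^2\<close> of \<open>p\<close>, up to a correction.\<close>
  have rX: "X\<^sup>2 * r = int e * int p + X * (Y + Z) - Y * Z - 2 * X\<^sup>2"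
  proof -
    have "X\<^sup>2 * r = X * (X * (k + 2)) - 2 * X\<^sup>2 - X\<^sup>2 * V * int p"
      by (simp add: r_def power2_eq_square algebra_simps V_def)
    also have "\<dots> = X * (Y * Z * W + Y + Z) - 2 * X\<^sup>2 - (Y * Z - int e) * int p"
      unfolding KK using AE by (simp add: mult.commute)
    also have "\<dots> = int e * int p + X * (Y + Z) - Y * Z - 2 * X\<^sup>2"
      unfolding P by (simp add: algebra_simps)
    finally show ?thesis .
  qed
  have e': "1 \<le> int e" "int e \<le> X\<^sup>2 - 1" using e unfolding X_def
    by (simp, metis Suc_leI e(2) of_nat_Suc of_nat_le_iff of_nat_power add.commute le_diff_eq)
  have X: "2 \<le> X" "4 \<le> X\<^sup>2" using x x2 by (simp_all add: X_def flip: of_nat_power)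
  have YZ: "2 \<le> Y * Z" using yz by (simp add: Y_def Z_def flip: of_nat_mult)
  have pos: "1 \<le> Y" "1 \<le> Z" using yz unfolding Y_def Z_def
    by (cases y; cases z; simp)+
  have W: "X * (Y * Z) \<le> W" using u by (simp add: X_def Y_def Z_def W_def flip: of_nat_mult)
  have P1: "1 \<le> int p" by (simp add: p_def)
  have PL: "X\<^sup>2 * (Y * Z) + 1 \<le> int p"
    unfolding P using mult_left_mono[OF W, of X] X by (simp add: power2_eq_square algebra_simps)
  \<comment> \<open>Since \<open>e >= 1\<close>, the right side contains a whole \<open>p\<close>,
    which outweighs the negative terms.\<close>
  have lower: "V \<le> r + 1"
  proof -
    have "X\<^sup>2 * V \<le> Y * Z" using AE e' by (simp add: mult.commute)
    moreover have "X\<^sup>2 * (r + 1) = int e * int p + X * (Y + Z) - Y * Z - X\<^sup>2"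
      using rX by (simp add: algebra_simps)
    moreover have "int p \<le> int e * int p" using e' P1 by simp
    moreover have "0 \<le> X * (Y + Z)" using X pos by simp
    moreover have "4 * (Y * Z) \<le> X\<^sup>2 * (Y * Z)" using X YZ by (intro mult_right_mono) auto
    moreover have "X\<^sup>2 * 2 \<le> X\<^sup>2 * (Y * Z)" using YZ by (intro mult_left_mono) auto
    ultimately have "X\<^sup>2 * V \<le> X\<^sup>2 * (r + 1)" using PL by linarith
    then show ?thesis using X by simp
  qed
  \<comment> \<open>Since \<open>e <= X^2 - 1\<close>, one \<open>p\<close> is to spare, and it
    exceeds \<open>X (Y + Z)\<close>.\<close>
  have upper: "r < int p"
  proof -
    have "int e * int p \<le> X\<^sup>2 * int p - int p"
      using mult_right_mono[OF e'(2), of "int p"] by (simp add: algebra_simps)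
    moreover have "X * (Y + Z) < int p"
    proof -
      have "0 \<le> (Y - 1) * (Z - 1)" using pos by simp
      then have "Y + Z \<le> Y * Z + 1" by (simp add: algebra_simps)
      also have "\<dots> \<le> 2 * (Y * Z)" using YZ by linarith
      also have "\<dots> \<le> X * (Y * Z)" using X YZ by (intro mult_right_mono) auto
      also have "\<dots> \<le> W" by (rule W)
      finally show ?thesis unfolding P using X mult_left_mono[of "Y+Z" W X] by linarith
    qed
    ultimately have "X\<^sup>2 * r < X\<^sup>2 * int p" using rX X YZ by linarith
    then show ?thesis using X by (simp add: mult_less_cancel_left)
  qed
  \<comment> \<open>For \<open>a = 0\<close> the bound \<open>lower\<close> gives only
    \<open>r >= -1\<close>, but then \<open>r\<close> is \<open>K - 2\<close>.\<close>
  have r0: "0 \<le> r"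
  proof (cases "a = 0")
    case True then show ?thesis using k0 by (simp add: r_def)
  next
    case False then show ?thesis using lower by (simp add: V_def)
  qed
  define \<rho> where "\<rho> = nat r"
  have \<rho>: "int \<rho> = r" using r0 by (simp add: \<rho>_def)
  have "int K = int (a * p + \<rho> + 2)" by (simp add: \<rho> r_def k_def)
  then have K': "K = a * p + \<rho> + 2" by (simp only: of_nat_eq_iff)
  have "(y * u + 1) * (z * u + 1) = 1 + u * (y * z * u + y + z)" by (simp add: algebra_simps)
  also have "\<dots> = 1 + (p - 1) * K" unfolding K by (simp add: p_def)
  finally have "(y * u + 1) * (z * u + 1) = 1 + (p - 1) * (a * p + \<rho> + 2)" unfolding K' .
  moreover have "a \<le> \<rho> + 1" "\<rho> < p" using lower upper \<rho> by (simp_all add: V_def)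
  moreover have "2 \<le> p" using x up by (simp add: p_def)
  ultimately show ?thesis using digit_sum_eq_base nd unfolding p_def by blast
qed

text \<open>For \<open>x = 1\<close> the division by \<open>x^2\<close> leaves no remainder, so the
  leading digit becomes \<open>y z - 1\<close>. The bound on \<open>u\<close> is the condition
  \<open>A <= \<rho> + 1\<close> of \<open>digit_sum_eq_base\<close>.\<close>

lemma digit_sum_two_factors_1:
  fixes y z u :: nat
  assumes yz: "1 \<le> y" "1 \<le> z" "2 \<le> y * z" and u: "2 * (y * z) \<le> u + y + z + 1"
    and u0: "1 \<le> u" and nd: "\<not> u + 1 dvd (y * u + 1) * (z * u + 1)"
  shows "digit_sum (u + 1) ((y * u + 1) * (z * u + 1)) = u + 1"
proof -
  define \<rho> where "\<rho> = u + y + z - y * z - 1"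
  have le: "y * z + 1 \<le> u + y + z" using u yz by linarith
  have yz': "y + z \<le> y * z + 1"
  proof -
    have "0 \<le> (int y - 1) * (int z - 1)" using yz by simp
    then have "int (y + z) \<le> int (y * z + 1)" by (simp add: algebra_simps)
    then show ?thesis by (simp only: of_nat_le_iff)
  qed
  have \<rho>: "int \<rho> = int u + int y + int z - int y * int z - 1"
    using le by (simp add: \<rho>_def of_nat_diff)
  have yz1: "int (y * z - 1) = int y * int z - 1" using yz(3) by (metis int_ops(2) int_ops(7) le_trans of_nat_diff one_le_numeral)
  have "int ((y * u + 1) * (z * u + 1)) = int (1 + (u + 1 - 1) * ((y * z - 1) * (u + 1) + \<rho> + 2))"
    unfolding add_diff_cancel_right' of_nat_add of_nat_mult yz1 \<rho> by (simp add: algebra_simps)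
  then have "(y * u + 1) * (z * u + 1) = 1 + (u + 1 - 1) * ((y * z - 1) * (u + 1) + \<rho> + 2)"
    by (simp only: of_nat_eq_iff)
  moreover have "y * z - 1 \<le> \<rho> + 1" "\<rho> < u + 1"
    using u le yz' by (simp_all add: \<rho>_def)
  ultimately show ?thesis using digit_sum_eq_base[of "u + 1"] nd u0 by auto
qed

section \<open>Composite bases and divisors\<close>

lemma digit_sum_mult_base_neq:
  assumes "1 < p" "1 < g" "p \<noteq> g" "p - 1 dvd g - 1"
  shows "digit_sum g (g * p) \<noteq> g"
proof -
  have "p - 1 \<le> g - 1" using assms by (intro dvd_imp_le) auto
  then have "p < g" using assms by linarith
  then show ?thesis using assms by (simp add: digit_sum_mult_base digit_sum_less)
qed

lemma dvd_prime_mult_cases: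
  fixes p g n :: nat
  assumes "prime p" "g dvd p * n"
  obtains "g dvd n" | h where "g = p * h" "h dvd n"
proof (cases "p dvd g")
  case True
  then obtain h where "g = p * h" by blast
  then show ?thesis using assms that by auto
next
  case False
  then have "coprime p g" using assms by (simp add: prime_imp_coprime)
  then show ?thesis using assms that by (metis coprime_commute coprime_dvd_mult_right_iff)
qed

section \<open>Arithmetic of \<open>u\<close>, the triple \<open>r\<close> and
  \<open>ell\<close>\<close>

lemma prime_triple_dvd:
  fixes p q r :: nat
  assumes "carmichael (p * (q * r))" "prime p" "prime q" "prime r"
  shows "p - 1 dvd q * r - 1"
proof -
  have "p > 0" "q * r > 0" using assms by (auto simp: prime_gt_0_nat)
  then have *: "p * (q * r) - 1 = (p - 1) * (q * r) + (q * r - 1)"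
    by (cases p) auto
  have "p - 1 dvd p * (q * r) - 1"
    using carmichael_korselt(2)[OF assms(1,2)] by simp
  then show ?thesis unfolding * by (simp add: dvd_add_right_iff)
qed

lemma quotient_dvd:
  fixes a b c u :: nat
  assumes "a * u dvd (b * u + 1) * (c * u + 1) - 1" "u > 0"
  shows "a dvd b * c * u + b + c"
proof -
  have "(b * u + 1) * (c * u + 1) - 1 = (b * c * u + b + c) * u"
    by (simp add: algebra_simps)
  then show ?thesis using assms by simp
qed

text \<open>A common divisor of \<open>a\<close> and \<open>b\<close> also divides \<open>c\<close>,
  hence the trivial gcd of all three.\<close>

lemma coprime_of_dvd:
  fixes a b c u :: nat
  assumes "gcd a (gcd b c) = 1" "a dvd b * c * u + b + c"
  shows "coprime a b"
proof (rule coprimeI)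
  fix d assume d: "d dvd a" "d dvd b"
  then have "d dvd b * c * u + b + c" using assms(2) dvd_trans by blast
  moreover have "d dvd b * c * u + b" using d(2) by simp
  ultimately have "d dvd c" using dvd_add_right_iff by blast
  then have "d dvd gcd a (gcd b c)" using d by simp
  then show "is_unit d" using assms(1) by simp
qed

text \<open>\<open>T = \<sigma>2 u + \<sigma>1\<close> reduces to the given linear forms modulo
  \<open>a\<close>, \<open>b\<close> and \<open>c\<close>, so the product of these divides
  \<open>T\<close>, and \<open>u\<close> solves the congruence defining \<open>ell\<close>.\<close>

lemma ell_eq_mod:
  fixes a b c u :: nat
  assumes cop: "coprime a b" "coprime a c" "coprime b c" and pos: "a > 0" "b > 0" "c > 0"
    and dv: "a dvd b * c * u + b + c" "b dvd a * c * u + a + c" "c dvd a * b * u + a + b"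
  shows "ell (a, b, c) = int u mod \<sigma>3 (a, b, c)"
proof -
  define s where "s = int (a * b * c)"
  define s2 where "s2 = int (a * b + a * c + b * c)"
  define s1 where "s1 = int (a + b + c)"
  have s: "s > 0" using pos by (simp add: s_def)
  define T where "T = u * (a * b + a * c + b * c) + (a + b + c)"
  have "T = (b * c * u + b + c) + a * (b * u + c * u + 1)"
    "T = (a * c * u + a + c) + b * (a * u + c * u + 1)"
    "T = (a * b * u + a + b) + c * (a * u + b * u + 1)"
    by (simp_all add: T_def algebra_simps)
  then have "a dvd T" "b dvd T" "c dvd T" using dv by (metis dvd_add dvd_triv_left)+
  then have "a * b * c dvd T" using cop by (simp add: divides_mult)
  then have "s dvd int T" by (simp only: s_def of_nat_dvd_iff)
  then have T: "[int u * s2 = - s1] (mod s)"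
    unfolding cong_iff_dvd_diff by (simp add: T_def s2_def s1_def algebra_simps)
  \<comment> \<open>Modulo each of \<open>a\<close>, \<open>b\<close>, \<open>c\<close> the sum is
    the product of the other two. Thus \<open>s2\<close> is invertible modulo \<open>s\<close>, and
    the solution is unique.\<close>
  have "coprime (a * b + a * c + b * c) a"
    "coprime (a * b + a * c + b * c) b" "coprime (a * b + a * c + b * c) c"
  proof -
    have *: "coprime (x * y + z) x" if "coprime z x" for x y z :: nat
      using that by (metis coprime_iff_gcd_eq_1 gcd.commute gcd_add_mult mult.commute add.commute)
    show "coprime (a * b + a * c + b * c) a"
      using *[of "b * c" a "b + c"] cop by (simp add: algebra_simps coprime_commute)
    show "coprime (a * b + a * c + b * c) b"
      using *[of "a * c" b "a + c"] cop by (simp add: algebra_simps coprime_commute)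
    show "coprime (a * b + a * c + b * c) c"
      using *[of "a * b" c "a + b"] cop by (simp add: algebra_simps coprime_commute)
  qed
  then have "coprime (a * b + a * c + b * c) (a * b * c)" by simp
  then have cs: "coprime s2 s" unfolding s2_def s_def by (simp only: coprime_int_iff)
  have "(THE l. 0 \<le> l \<and> l < s \<and> [l * s2 = - s1] (mod s)) = int u mod s"
  proof (rule the_equality)
    have "[int u mod s * s2 = int u * s2] (mod s)"
      by (simp add: cong_def mod_mult_left_eq)
    then show "0 \<le> int u mod s \<and> int u mod s < s \<and> [int u mod s * s2 = - s1] (mod s)"
      using s T by (auto intro: cong_trans)
  next
    fix l assume l: "0 \<le> l \<and> l < s \<and> [l * s2 = - s1] (mod s)"
    then have "[l * s2 = int u * s2] (mod s)" using T by (meson cong_sym cong_trans)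
    then have "[l = int u] (mod s)" using cs by (simp add: cong_mult_rcancel)
    then show "l = int u mod s" using l by (simp add: cong_def)
  qed
  then show ?thesis by (simp add: ell_def s_def s2_def s1_def)
qed

text \<open>By division with remainder, \<open>\<sigma>3 * t + ell\<close> is \<open>u\<close> again
  at this \<open>t\<close>.\<close>

lemma U_div:
  assumes "ell (a, b, c) = int u mod \<sigma>3 (a, b, c)"
  shows "U (a, b, c) (int u div \<sigma>3 (a, b, c)) = int ((a * u + 1) * ((b * u + 1) * (c * u + 1)))"
  unfolding U_def assms prod.case mult_div_mod_eq by (simp add: algebra_simps)

lemma mult_linear_less:
  fixes a b c v w :: int
  assumes "0 < a" "0 < b" "0 < c" "0 \<le> v" "v < w"
  shows "(a * v + 1) * (b * v + 1) * (c * v + 1) < (a * w + 1) * (b * w + 1) * (c * w + 1)"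
proof -
  have less: "x * v + 1 < x * w + 1" and pos: "0 < x * v + 1" if "0 < x" for x
    using assms(4) mult_strict_left_mono[OF assms(5) that] that
    by (linarith, simp add: add_nonneg_pos)
  have w: "0 < x * w + 1" if "0 < x" for x
    using less[OF that] pos[OF that] by linarith
  have "(a * v + 1) * (b * v + 1) < (a * w + 1) * (b * w + 1)"
    using assms(1,2) less pos w by (intro mult_strict_mono) (auto intro: less_imp_le)
  then show ?thesis
    using assms(1-3) less pos w by (intro mult_strict_mono) (auto intro: less_imp_le)
qed

text \<open>The last claim of the theorem concerns any \<open>t\<close> that represents
  \<open>m\<close>; monotonicity ties it to the quotient of \<open>u\<close> by
  \<open>\<sigma>3\<close>.\<close>

lemma U_strict_mono:
  assumes "ell (a, b, c) = int u mod \<sigma>3 (a, b, c)" "0 < a" "0 < b" "0 < c" "0 \<le> s" "s < t"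
  shows "U (a, b, c) s < U (a, b, c) t"
proof -
  have "0 < \<sigma>3 (a, b, c)" using assms by simp
  moreover from this have "0 \<le> ell (a, b, c)" unfolding assms(1) by (rule pos_mod_sign)
  ultimately show ?thesis
    unfolding U_def prod.case using assms
    by (intro mult_linear_less) (auto intro: mult_strict_left_mono)
qed

section \<open>Decompositions of a product of three primes\<close>

lemma squarefree_three_primes:
  fixes m :: nat
  assumes "squarefree m" "card (prime_factors m) = 3"
  obtains p q r where "prime p" "prime q" "prime r" "p < q" "q < r" "m = p * (q * r)"
    "prime_factors m = {p, q, r}"
proof -
  have m: "m \<noteq> 0" using assms(2) by (metis card.empty prime_factorization_0 set_mset_empty zero_neq_numeral)
  obtain x y z where xyz: "prime_factors m = {x, y, z}" "x \<noteq> y" "y \<noteq> z" "x \<noteq> z"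
    using assms(2) card_3_iff by metis
  have "m = (\<Prod>p\<in>prime_factors m. p ^ multiplicity p m)"
    using prod_prime_factors[OF m] by simp
  also have "\<dots> = (\<Prod>p\<in>prime_factors m. p)"
    using assms(1) squarefree_factorial_semiring'[OF m] by (intro prod.cong) auto
  also have "\<dots> = x * (y * z)" using xyz by simp
  finally have eq: "m = x * (y * z)" .
  have pr: "prime x" "prime y" "prime z" using xyz(1) by (metis in_prime_factors_imp_prime insertCI)+
  consider "x < y \<and> y < z" | "x < z \<and> z < y" | "y < x \<and> x < z" | "y < z \<and> z < x"
    | "z < x \<and> x < y" | "z < y \<and> y < x"
    using xyz by linarith
  then show ?thesis
    by cases (use that eq pr xyz(1) in \<open>auto simp: mult_ac insert_commute\<close>)
qed

lemma proper_divisor_of_three_primes: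
  fixes p q r g :: nat
  assumes "prime p" "prime q" "prime r" "g dvd p * (q * r)" "1 < g" "g < p * (q * r)"
  shows "g \<in> {p, q, r, q * r, p * r, p * q}"
proof -
  have triv: "h = 1 \<or> h = r" if "h dvd r" for h
    using that assms(3) by (simp add: prime_nat_iff)
  have two: "h \<in> {1, q, r, q * r}" if "h dvd q * r" for h
    using assms(2) that by (rule dvd_prime_mult_cases) (use triv in auto)
  show ?thesis
    using assms(1,4) by (rule dvd_prime_mult_cases) (use two assms(5,6) in fastforce)+
qed

text \<open>Products of two primes are excluded as strict bases by
  \<open>digit_sum_mult_base_neq\<close>. All bases are then prime, and each prime factor of the
  product must occur among them.\<close>

lemma three_primes_mem_\<S>_strict:
  fixes p q r :: nat
  assumes pr: "prime p" "prime q" "prime r"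
    and dv: "p - 1 dvd q * r - 1" "q - 1 dvd p * r - 1" "r - 1 dvd p * q - 1"
    and m: "p * (q * r) \<in> \<S>"
  shows "digit_sum p (p * (q * r)) = p" "digit_sum q (p * (q * r)) = q"
    "digit_sum r (p * (q * r)) = r"
proof -
  define m where "m = p * (q * r)"
  obtain G e where G: "proper_factorization m G e" "\<And>g. g \<in> G \<Longrightarrow> digit_sum g m = g"
    using m unfolding \<S>_def strict_s_decomposition_def s_decomposition_def m_def by blast
  then have fin: "finite G" and eq: "m = (\<Prod>g\<in>G. g ^ e g)"
    and bd: "\<And>g. g \<in> G \<Longrightarrow> 1 < g \<and> g < m \<and> 1 \<le> e g"
    unfolding proper_factorization_def by auto
  have gt: "1 < p" "1 < q" "1 < r" using pr prime_gt_1_nat by blast+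
  have gt2: "1 < q * r" "1 < p * r" "1 < p * q" using gt by (simp_all only: less_1_mult)
  have np: "\<not> prime (q * r)" "\<not> prime (p * r)" "\<not> prime (p * q)"
    using gt by (metis prime_product less_irrefl)+
  have G3: "g \<in> {p, q, r}" if g: "g \<in> G" for g
  proof -
    have "g dvd g ^ e g" using bd[OF g] by (intro dvd_power) auto
    also have "\<dots> dvd m" unfolding eq using fin g by (rule dvd_prodI)
    finally have "g \<in> {p, q, r, q * r, p * r, p * q}"
      using proper_divisor_of_three_primes[OF pr] bd[OF g] unfolding m_def by blast
    moreover have "digit_sum (q * r) m \<noteq> q * r"
    proof -
      have "p \<noteq> q * r" using np pr by metis
      then show ?thesis using digit_sum_mult_base_neq[of p "q * r"] gt gt2 dv
        by (simp add: m_def mult_ac)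
    qed
    moreover have "digit_sum (p * r) m \<noteq> p * r"
    proof -
      have "q \<noteq> p * r" using np pr by metis
      then show ?thesis using digit_sum_mult_base_neq[of q "p * r"] gt gt2 dv
        by (simp add: m_def mult_ac)
    qed
    moreover have "digit_sum (p * q) m \<noteq> p * q"
    proof -
      have "r \<noteq> p * q" using np pr by metis
      then show ?thesis using digit_sum_mult_base_neq[of r "p * q"] gt gt2 dv
        by (simp add: m_def mult_ac)
    qed
    ultimately show ?thesis using G(2)[OF g] by auto
  qed
  have mem: "x \<in> G" if x: "prime x" "x dvd m" for x
  proof -
    have "\<exists>g\<in>G. x dvd g ^ e g"
      using x fin unfolding eq by (simp add: prime_dvd_prod_iff)
    then obtain g where g: "g \<in> G" "x dvd g" using x(1) prime_dvd_power by blast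
    then have "prime g" using G3 pr by auto
    then have "x = g" using g x(1) primes_dvd_imp_eq by blast
    then show ?thesis using g by simp
  qed
  show "digit_sum p (p * (q * r)) = p" "digit_sum q (p * (q * r)) = q"
    "digit_sum r (p * (q * r)) = r"
    using G(2) mem pr by (auto simp: m_def)
qed

section \<open>Three-prime Carmichael numbers outside \<open>\<C>3'\<close>\<close>

theorem theorem5p2:
  fixes m :: nat
  assumes "carmichael m"
    and "card (prime_factors m) = 3"
    and "m \<notin> \<C>3'"
  shows "m \<in> (\<S>' \<inter> \<L>) - \<S>
    \<and> digit_sum (Max (prime_factors m)) m = Max (prime_factors m)
    \<and> (\<exists>p1 p2 p3. prime p1 \<and> prime p2 \<and> prime p3 \<and> p1 < p2 \<and> p2 < p3 \<and> m = p1 * p2 * p3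
        \<and> (let u = gcd (p1 - 1) (gcd (p2 - 1) (p3 - 1));
               r = ((p1 - 1) div u, (p2 - 1) div u, (p3 - 1) div u)
           in r \<in> \<R>
              \<and> (\<exists>t. 0 \<le> t \<and> t < \<tau> r \<and> int m = U r t)
              \<and> (\<forall>t. 0 \<le> t \<and> t < \<tau> r \<and> int m = U r t \<and> (\<tau> r, t) = (2, 1)
                    \<longrightarrow> digit_sum p2 m = p2)))"
proof -
  have sf: "squarefree m" using carmichael_korselt(1) assms(1) .
  obtain p q r where pr: "prime p" "prime q" "prime r" and less: "p < q" "q < r"
    and m: "m = p * (q * r)" and pf: "prime_factors m = {p, q, r}"
    using squarefree_three_primes[OF sf assms(2)] .
  have m': "m = q * (p * r)" "m = r * (p * q)" by (simp_all add: m)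
  have dv: "p - 1 dvd q * r - 1" "q - 1 dvd p * r - 1" "r - 1 dvd p * q - 1"
    using prime_triple_dvd[of p q r] prime_triple_dvd[of q p r] prime_triple_dvd[of r p q]
      assms(1) pr m'[symmetric] m[symmetric] by simp_all
  have gt: "1 < p" "1 < q" "1 < r" using pr prime_gt_1_nat by blast+
  have ndvd: "\<not> p dvd q * r" "\<not> q dvd p * r" "\<not> r dvd p * q"
    using pr less by (metis prime_dvd_mult_iff primes_dvd_imp_eq less_irrefl less_trans)+
  have dsm: "digit_sum p m = digit_sum p (q * r)" "digit_sum q m = digit_sum q (p * r)"
    "digit_sum r m = digit_sum r (p * q)"
    using gt digit_sum_mult_base[of p "q * r"] digit_sum_mult_base[of q "p * r"]
      digit_sum_mult_base[of r "p * q"] unfolding m[symmetric] m'[symmetric] by simp_all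
  \<comment> \<open>For the largest prime the cofactor satisfies \<open>p * q < r * r\<close>, so
    two digits suffice.\<close>
  have r_strict: "digit_sum r m = r"
    unfolding dsm using gt dv ndvd less
    by (intro digit_sum_eq_base_small less_1_mult mult_strict_mono) auto
  \<comment> \<open>As \<open>r\<close> is already strict, lying outside \<open>\<C>3'\<close> must
    come from \<open>p\<close> or \<open>q\<close>. Both \<open>m \<notin> \<S>\<close> and the
    bound on \<open>t\<close> contradict this fact if they fail.\<close>
  have not_strict: "\<not> (digit_sum p m = p \<and> digit_sum q m = q)"
  proof
    assume *: "digit_sum p m = p \<and> digit_sum q m = q"
    have "m > 1" using assms(1) by (simp add: carmichael_def)
    moreover have "x \<in> {p, q, r}" if "prime x" "x dvd m" for x
      using that \<open>m > 1\<close> unfolding pf[symmetric] by (simp add: in_prime_factors_iff)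
    ultimately have "m \<in> \<C>3'"
      using sf assms(2) * r_strict unfolding \<C>3'_def by auto
    then show False using assms(3) by simp
  qed

  have lt: "p < m" "q < m" "r < m"
  proof -
    have *: "x < x * y" if "1 < x" "1 < y" for x y :: nat using that by simp
    show "p < m" "q < m" "r < m"
      using gt *[OF _ less_1_mult] unfolding m by (metis mult.left_commute mult.commute)+
  qed
  have ge: "x \<le> digit_sum x m" if x: "x \<in> {p, q, r}" for x
  proof (rule digit_sum_ge_base)
    have px: "prime x" "x dvd m" using x pr by (auto simp: m)
    show "2 \<le> x" using px(1) by (rule prime_ge_2_nat)
    show "m > 0" using lt by simp
    show "x - 1 dvd m - 1" using carmichael_korselt(2)[OF assms(1)] px by blast
    show "m \<noteq> x ^ k" for k
    proof
      assume "m = x ^ k"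
      then have "p dvd x ^ k" "q dvd x ^ k" by (simp_all add: m flip: \<open>m = x ^ k\<close>)
      then have "p = x" "q = x" using pr px(1) by (metis prime_dvd_power primes_dvd_imp_eq)+
      then show False using less by simp
    qed
  qed
  have "s_decomposition m {p, q, r} (\<lambda>_. 1)"
    using lt gt ge less m by (auto simp: s_decomposition_def proper_factorization_def)
  then have S': "m \<in> \<S>'" using lt by (auto simp: \<S>'_def)
  have L: "m \<in> \<L>" 
  proof -
    have "r dvd m" "0 < m" using lt by (simp_all add: m)
    moreover have "2 \<le> r" using gt by simp
    ultimately show ?thesis using r_strict lt unfolding \<L>_def by blast
  qed
  have S: "m \<notin> \<S>"
    using three_primes_mem_\<S>_strict[OF pr dv] not_strict unfolding m[symmetric] by blast
  have Max: "Max (prime_factors m) = r" using pf less by (auto simp: max_def)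

  define u where "u = gcd (p - 1) (gcd (q - 1) (r - 1))"
  define a where "a = (p - 1) div u"
  define b where "b = (q - 1) div u"
  define c where "c = (r - 1) div u"
  have u: "u > 0" using gt by (simp add: u_def)
  have "u dvd p - 1" "u dvd q - 1" "u dvd r - 1" unfolding u_def by (auto intro: dvd_trans)
  then have au: "p - 1 = a * u" and bu: "q - 1 = b * u" and cu: "r - 1 = c * u"
    by (simp_all add: a_def b_def c_def)
  then have pqr: "p = a * u + 1" "q = b * u + 1" "r = c * u + 1" using gt by linarith+
  have gcd: "gcd a (gcd b c) = 1"
  proof -
    have "u * gcd a (gcd b c) = gcd (a * u) (gcd (b * u) (c * u))"
      unfolding gcd_mult_distrib_nat by (simp only: mult.commute)
    also have "\<dots> = u" unfolding au[symmetric] bu[symmetric] cu[symmetric] by (rule u_def[symmetric])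
    finally show ?thesis using u by simp
  qed
  have abc: "0 < a" "a < b" "b < c" using gt less pqr by auto
  have dvr: "a dvd b * c * u + b + c" "b dvd a * c * u + a + c" "c dvd a * b * u + a + b"
    using quotient_dvd[of a u b c] quotient_dvd[of b u a c] quotient_dvd[of c u a b] u dv
    unfolding au bu cu unfolding pqr by simp_all
  have cop: "coprime a b" "coprime a c" "coprime b c"
  proof -
    show "coprime a b" using gcd dvr(1) by (rule coprime_of_dvd)
    have "gcd a (gcd c b) = 1" using gcd by (simp only: gcd.commute[of c b])
    moreover have "a dvd c * b * u + c + b" using dvr(1) by (simp only: ac_simps)
    ultimately show "coprime a c" by (rule coprime_of_dvd)
    have "gcd b (gcd c a) = 1" using gcd by (simp only: ac_simps)
    moreover have "b dvd c * a * u + c + a" using dvr(2) by (simp only: ac_simps)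
    ultimately show "coprime b c" by (rule coprime_of_dvd)
  qed
  have ell: "ell (a, b, c) = int u mod \<sigma>3 (a, b, c)"
    using ell_eq_mod[OF cop _ _ _ dvr] abc by simp
  have R: "(a, b, c) \<in> \<R>" using abc cop by (simp add: \<R>_def)
  define s where "s = \<sigma>3 (a, b, c)"
  have s: "s = int (a * b * c)" "0 < s" using abc by (simp_all add: s_def)
  define t where "t = int u div s"
  have Ut: "int m = U (a, b, c) t"
    using U_div[OF ell] unfolding t_def s_def m pqr by simp
  have t0: "0 \<le> t" using s by (simp add: t_def pos_imp_zdiv_nonneg_iff)
  have ut: "int u = s * t + ell (a, b, c)" unfolding ell t_def s_def by simp
  have ell0: "0 \<le> ell (a, b, c)" unfolding ell using s s_def by simp
  have u_ge: "a * b * c \<le> u" if "1 \<le> t"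
  proof -
    have "s * 1 \<le> s * t" using s that by (intro mult_left_mono) auto
    then show ?thesis using ut ell0 s by linarith
  qed
  \<comment> \<open>\<open>a < b\<close> forces \<open>b >= 2\<close>, so the exceptional case of a
    quotient \<open>1\<close> never concerns \<open>q\<close>.\<close>
  have q_strict: "digit_sum q m = q" if "1 \<le> t"
  proof -
    have "2 \<le> b" "2 \<le> c" using abc by linarith+
    moreover from this have "2 \<le> a * c" using abc mult_le_mono[of 1 a 2 c] by simp
    ultimately show ?thesis
      using digit_sum_two_factors_ge2[of b a c u] u_ge[OF that] cop dvr ndvd
      unfolding dsm unfolding pqr by (simp add: ac_simps)
  qed
  have p_strict: "digit_sum p m = p" if t: "\<tau> (a, b, c) \<le> t"
  proof -
    have t1: "1 \<le> t" using t by (simp add: \<tau>_def split: if_splits)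
    have bc: "2 \<le> b * c" using abc mult_le_mono[of 1 b 2 c] by simp
    show ?thesis
    proof (cases "a = 1")
      case False
      then show ?thesis
        using digit_sum_two_factors_ge2[of a b c u] u_ge[OF t1] bc cop dvr ndvd abc
        unfolding dsm unfolding pqr by simp
    next
      case True
      \<comment> \<open>For \<open>a = 1\<close> this is the bound
        \<open>2 b c <= u + b + c + 1\<close> needed below. With \<open>u = s t + ell\<close>,
        \<open>t = 1\<close> suffices if \<open>ell >= s - \<sigma>1\<close>; otherwise
        \<open>t >= 2\<close> is required, which is the case split in \<open>\<tau>\<close>.\<close>
      have "2 * s - \<sigma>1 (a, b, c) \<le> int u"
      proof (cases "ell (a, b, c) < s - \<sigma>1 (a, b, c)")
        case True
        then have "2 \<le> t" using t \<open>a = 1\<close> by (simp add: \<tau>_def s_def)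
        then have "s * 2 \<le> s * t" using s by (intro mult_left_mono) auto
        moreover have "0 \<le> \<sigma>1 (a, b, c)" by simp
        ultimately show ?thesis using ut ell0 by linarith
      next
        case False
        have "s * 1 \<le> s * t" using s t1 by (intro mult_left_mono) auto
        then show ?thesis using ut False by linarith
      qed
      then have "2 * (b * c) \<le> u + b + c + 1"
        unfolding s \<open>a = 1\<close> by (simp flip: of_nat_mult of_nat_add)
      then show ?thesis
        using digit_sum_two_factors_1[of b c u] bc abc u ndvd \<open>a = 1\<close>
        unfolding dsm unfolding pqr by simp
    qed
  qed
  have t_less: "t < \<tau> (a, b, c)"
  proof (rule ccontr)
    assume "\<not> t < \<tau> (a, b, c)"
    then have "\<tau> (a, b, c) \<le> t" "1 \<le> t" by (auto simp: \<tau>_def split: if_splits)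
    then show False using p_strict q_strict not_strict by blast
  qed
  have second: "digit_sum q m = q" if "int m = U (a, b, c) 1"
  proof (rule q_strict, rule ccontr)
    assume "\<not> 1 \<le> t"
    then have "U (a, b, c) t < U (a, b, c) 1"
      using U_strict_mono[OF ell] abc t0 by simp
    then show False using that Ut by simp
  qed

  show ?thesis
    unfolding Max
  proof (intro conjI, use S' L S in blast, rule r_strict,
      rule exI[of _ p], rule exI[of _ q], rule exI[of _ r], intro conjI)
    show "m = p * q * r" by (simp add: m)
    show "let u = gcd (p - 1) (gcd (q - 1) (r - 1));
               r = ((p - 1) div u, (q - 1) div u, (r - 1) div u)
           in r \<in> \<R>
              \<and> (\<exists>t. 0 \<le> t \<and> t < \<tau> r \<and> int m = U r t)
              \<and> (\<forall>t. 0 \<le> t \<and> t < \<tau> r \<and> int m = U r t \<and> (\<tau> r, t) = (2, 1)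
                    \<longrightarrow> digit_sum q m = q)"
      unfolding Let_def u_def[symmetric] a_def[symmetric] b_def[symmetric] c_def[symmetric]
      using R t0 t_less Ut second by auto
  qed (fact pr less)+
qed

end
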